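(* Let $X$ be a separable Hausdorff topological space with countable tightness. Then $X$ is dense-separable.
   Context: All spaces are Hausdorff. A space $X$ has countable tightness if, for any subset $A\subseteq X$ and any point $x\in\overline{A}$, there is a countable subset $D\subseteq A$ with $x\in\overline{D}$. A space is dense-separable if each of its dense subspaces is separable. *)

theory Defs
  imports "HOL-Analysis.Analysis"
begin

definition countable_tightness :: "'a topology \<Rightarrow> bool"
  where "countable_tightness X \<longleftrightarrow>
    (\<forall>A x. A \<subseteq> topspace X \<and> x \<in> X closure_of A \<longrightarrow>
      (\<exists>D. countable D \<and> D \<subseteq> A \<and> x \<in> X closure_of D))"

definition dense_separable :: "'a topology \<Rightarrow> bool"
  where "dense_separable X \<longleftrightarrow>
    (\<forall>S. S \<subseteq> topspace X \<and> X closure_of S = topspace X \<longrightarrow>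
      separable_space (subtopology X S))"

end

theory Submission
  imports Defs
begin

text \<open>
  Let \<open>S\<close> be a dense subspace and \<open>C\<close> a countable dense subset of \<open>X\<close>.  Each point of \<open>C\<close> lies
  in the closure of \<open>S\<close>, so countable tightness places it in the closure of a countable subset
  of \<open>S\<close>.  Countably many such choices have a countable union \<open>E\<close>, a subset of \<open>S\<close> whose closure
  contains \<open>C\<close> and hence the closure of \<open>C\<close>, which is all of \<open>X\<close>.  Since \<open>E\<close> lies in \<open>S\<close>, its
  closure relative to \<open>S\<close> is the trace on \<open>S\<close> of its closure in \<open>X\<close>, so \<open>E\<close> is dense in \<open>S\<close>.
\<close>

theorem proposition2p2:
  fixes X :: "'a topology"
  assumes "Hausdorff_space X"
    and "separable_space X"
    and "countable_tightness X"
  shows "dense_separable X"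
  unfolding dense_separable_def
proof (intro allI impI, elim conjE)
  fix S
  assume S: "S \<subseteq> topspace X" and S_dense: "X closure_of S = topspace X"
  obtain C where C: "countable C" "C \<subseteq> topspace X" and C_dense: "X closure_of C = topspace X"
    using assms(2) unfolding separable_space_def by auto
  have "\<exists>D. countable D \<and> D \<subseteq> S \<and> c \<in> X closure_of D" if "c \<in> C" for c
  proof -
    have "c \<in> X closure_of S"
      using that C S_dense by auto
    then show ?thesis
      using assms(3)[unfolded countable_tightness_def, rule_format, of S c] S by simp
  qed
  then obtain D where D: "\<And>c. c \<in> C \<Longrightarrow> countable (D c) \<and> D c \<subseteq> S \<and> c \<in> X closure_of D c"
    by metis
  define E where "E = (\<Union>c\<in>C. D c)"
  have E: "countable E" "E \<subseteq> S"
    using C D unfolding E_def by auto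
  have "C \<subseteq> X closure_of E"
  proof
    fix c assume "c \<in> C"
    then have "c \<in> X closure_of D c" "D c \<subseteq> E"
      using D unfolding E_def by auto
    then show "c \<in> X closure_of E"
      using closure_of_mono[of "D c" E X] by blast
  qed
  then have "topspace X \<subseteq> X closure_of E"
    using closure_of_minimal[OF _ closedin_closure_of, of C X E] C_dense by simp
  then have "subtopology X S closure_of E = topspace (subtopology X S)"
    using E S by (simp add: closure_of_subtopology Int_absorb1 Int_absorb2)
  then show "separable_space (subtopology X S)"
    unfolding separable_space_def using E S by (intro exI[of _ E]) auto
qed

end
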